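(* Let $G$ be a graph on $n$ vertices and let $C$ be a longest cycle in $G$, of length $c$, where $4\leq c\leq n-1$. If $e(G-V(C))+e(G-V(C),V(C))>(\lfloor c/2\rfloor-1)(n-c)$, then one of the following holds: (a) $c\in\{6,7,9\}$; (b) there exists a vertex $u\notin V(C)$ with exactly $\lfloor c/2\rfloor$ neighbors in $V(C)$; (c) there exists a cycle $C'$ in $G$ with $|V(C)\cap V(C')|\leq 1$ such that $|C'|\geq 2\lfloor c/2\rfloor-3$ if $V(C)\cap V(C')=\emptyset$, and $|C'|\geq 2\lfloor c/2\rfloor-1$ if $|V(C)\cap V(C')|=1$.
   Context: Graphs are simple and finite. $|C'|$ denotes the length (number of vertices) of the cycle $C'$. $e(G-V(C),V(C))$ is the number of edges with exactly one endpoint in $V(C)$. *)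

theory Defs
  imports Main
begin

definition simple_graph :: "'a set \<Rightarrow> 'a set set \<Rightarrow> bool" where
  "simple_graph V E \<longleftrightarrow> finite V \<and> (\<forall>e\<in>E. e \<subseteq> V \<and> card e = 2)"

text \<open>A cycle is given by the list of its vertices in cyclic order (each vertex listed once), so
  that \<open>set xs\<close> is its vertex set and \<open>length xs\<close> its length.\<close>

definition is_cycle :: "'a set \<Rightarrow> 'a set set \<Rightarrow> 'a list \<Rightarrow> bool" where
  "is_cycle V E xs \<longleftrightarrow> 3 \<le> length xs \<and> distinct xs \<and> set xs \<subseteq> V \<and>
     (\<forall>i<length xs. {xs ! i, xs ! (Suc i mod length xs)} \<in> E)"

definition longest_cycle :: "'a set \<Rightarrow> 'a set set \<Rightarrow> 'a list \<Rightarrow> bool" where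
  "longest_cycle V E xs \<longleftrightarrow> is_cycle V E xs \<and> (\<forall>ys. is_cycle V E ys \<longrightarrow> length ys \<le> length xs)"

definition edges_within :: "'a set set \<Rightarrow> 'a set \<Rightarrow> 'a set set" where
  "edges_within E A = {e \<in> E. e \<subseteq> A}"

definition edges_between :: "'a set set \<Rightarrow> 'a set \<Rightarrow> 'a set \<Rightarrow> 'a set set" where
  "edges_between E A B = {e \<in> E. \<exists>a\<in>A. \<exists>b\<in>B. e = {a, b}}"

definition neighbors_in :: "'a set set \<Rightarrow> 'a \<Rightarrow> 'a set \<Rightarrow> 'a set" where
  "neighbors_in E u A = {v \<in> A. {u, v} \<in> E}"

end

theory Submission
  imports Defs
begin

text \<open>
  Write \<open>k\<close> for half the length of \<open>C\<close>, rounded down. A minimal set \<open>D\<close> of vertices outside \<open>C\<close>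
  that is incident with more than \<open>(k - 1) |D|\<close> of the edges inside \<open>D \<union> C\<close> is hereditarily dense:
  every nonempty \<open>S \<subseteq> D\<close> is incident with more than \<open>(k - 1) |S|\<close> of these edges.

  Since \<open>C\<close> is longest, a neighbor on \<open>C\<close> of one end of a path with \<open>p\<close> vertices outside \<open>C\<close> is at
  distance at least \<open>p + 1\<close> along \<open>C\<close> from every other neighbor of the opposite end. Suppose both
  ends of a longest path in \<open>D\<close> have neighbors on \<open>C\<close>, together at least two. Weighing these gaps
  against the degrees, which are at least \<open>k\<close>, shows that both ends have the same neighbors on \<open>C\<close>
  and that each end is adjacent to the whole path. Rotations then carry this over to every vertex
  of the path, and the density of its vertex set forces \<open>p \<le> 2\<close>. For \<open>p = 2\<close> the cycle \<open>C\<close> has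
  length 6, 7 or 9, and for \<open>p = 1\<close> the path is a vertex with \<open>k\<close> neighbors on \<open>C\<close>.

  In the remaining cases there are a vertex \<open>z\<close> and \<open>b \<le> 1\<close> such that every longest path in \<open>D\<close> that
  ends in \<open>z\<close> starts in a vertex with at most \<open>b\<close> neighbors on \<open>C\<close>. Among these paths choose one
  whose first vertex is adjacent to the last vertex of an initial segment \<open>T\<close> that is as long as
  possible. Rearranging \<open>T\<close> by rotations yields \<open>|S|\<close> first vertices, each with at most \<open>|S|\<close>
  neighbors in \<open>D\<close>, all of them in \<open>T\<close>. The density of \<open>S\<close> gives \<open>2 (k - 1) < |T| + 2 b\<close>, so \<open>T\<close>
  closes to a long cycle. Only \<open>k = 2\<close>, \<open>b = 1\<close> is too weak; there a longest path together with
  a common neighbor of its ends is the required cycle.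
\<close>

section \<open>Paths and rotations\<close>

definition graph_path :: "'a set set \<Rightarrow> 'a set \<Rightarrow> 'a list \<Rightarrow> bool" where
  "graph_path E D xs \<longleftrightarrow> xs \<noteq> [] \<and> distinct xs \<and> set xs \<subseteq> D
     \<and> successively (\<lambda>x y. {x, y} \<in> E) xs"

lemma graph_pathD:
  assumes "graph_path E D xs"
  shows "xs \<noteq> []" "distinct xs" "set xs \<subseteq> D" "hd xs \<in> D" "last xs \<in> D"
  using assms hd_in_set[of xs] last_in_set[of xs] by (auto simp: graph_path_def)

lemma graph_path_singleton [simp]: "graph_path E D [x] \<longleftrightarrow> x \<in> D"
  by (simp add: graph_path_def)

lemma graph_path_rev [simp]: "graph_path E D (rev xs) \<longleftrightarrow> graph_path E D xs"
  by (simp add: graph_path_def insert_commute)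

lemma graph_path_superset:
  assumes "graph_path E D xs" "set xs \<subseteq> D'"
  shows "graph_path E D' xs"
  using assms by (simp add: graph_path_def)

lemma graph_path_append:
  assumes "xs \<noteq> []" "ys \<noteq> []"
  shows "graph_path E D (xs @ ys) \<longleftrightarrow> graph_path E D xs \<and> graph_path E D ys
    \<and> set xs \<inter> set ys = {} \<and> {last xs, hd ys} \<in> E"
  using assms by (auto simp: graph_path_def successively_append_iff)

lemma graph_path_prefix:
  assumes "graph_path E D (xs @ ys)" "xs \<noteq> []"
  shows "graph_path E D xs"
  using assms by (cases "ys = []") (auto simp: graph_path_append)

lemma graph_path_rotation:
  assumes "graph_path E D (us @ ws)" "us \<noteq> []" "ws \<noteq> []" "{hd us, hd ws} \<in> E"
  shows "graph_path E D (rev us @ ws)"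
  using assms by (simp add: graph_path_append last_rev)

definition spanning_path_to :: "'a set set \<Rightarrow> 'a set \<Rightarrow> 'a \<Rightarrow> 'a list \<Rightarrow> bool" where
  "spanning_path_to E T z xs \<longleftrightarrow> graph_path E T xs \<and> set xs = T \<and> last xs = z"

lemma spanning_path_to_self:
  assumes "graph_path E D xs"
  shows "spanning_path_to E (set xs) (last xs) xs"
  using assms by (simp add: spanning_path_to_def graph_path_superset)

definition rotation_ends :: "'a set set \<Rightarrow> 'a list \<Rightarrow> 'a set" where
  "rotation_ends E xs = {xs ! i |i. Suc i < length xs \<and> {hd xs, xs ! Suc i} \<in> E}"

lemma spanning_path_from_rotation_end:
  assumes spanning: "spanning_path_to E T z xs" and rotation_end: "x \<in> rotation_ends E xs"
  obtains ys where "spanning_path_to E T z ys" "hd ys = x"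
proof -
  obtain i where i: "Suc i < length xs" "{hd xs, xs ! Suc i} \<in> E" "x = xs ! i"
    using rotation_end by (auto simp: rotation_ends_def)
  define us ws where "us = take (Suc i) xs" and "ws = drop (Suc i) xs"
  have split: "xs = us @ ws" and nonempty: "us \<noteq> []" "ws \<noteq> []"
    using i(1) by (auto simp: us_def ws_def)
  have "hd ws = xs ! Suc i" and "last us = x"
    using i by (simp_all add: us_def ws_def hd_drop_conv_nth take_Suc_conv_app_nth)
  moreover have "graph_path E T (rev us @ ws)"
    using spanning i(2) \<open>hd ws = xs ! Suc i\<close> nonempty unfolding spanning_path_to_def split
    by (intro graph_path_rotation) auto
  ultimately show thesis
    using that[of "rev us @ ws"] spanning nonempty
    by (auto simp: spanning_path_to_def split hd_rev)
qed

lemma card_rotation_ends: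
  assumes "distinct xs" "{hd xs} \<notin> E"
  shows "card (rotation_ends E xs) = card (neighbors_in E (hd xs) (set xs))"
proof -
  define I where "I = {i. Suc i < length xs \<and> {hd xs, xs ! Suc i} \<in> E}"
  have "neighbors_in E (hd xs) (set xs) \<subseteq> (\<lambda>i. xs ! Suc i) ` I"
  proof
    fix v assume "v \<in> neighbors_in E (hd xs) (set xs)"
    then obtain j where j: "j < length xs" "xs ! j = v" "{hd xs, v} \<in> E"
      by (auto simp: neighbors_in_def in_set_conv_nth)
    then have "j \<noteq> 0" using assms(2) by (cases xs) (auto intro: gr0I)
    then show "v \<in> (\<lambda>i. xs ! Suc i) ` I"
      using j by (intro image_eqI[of _ _ "j - 1"]) (auto simp: I_def)
  qed
  then have "neighbors_in E (hd xs) (set xs) = (\<lambda>i. xs ! Suc i) ` I"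
    by (auto simp: I_def neighbors_in_def)
  moreover have "rotation_ends E xs = (!) xs ` I"
    by (auto simp: rotation_ends_def I_def)
  moreover have "inj_on (\<lambda>i. xs ! Suc i) I" "inj_on ((!) xs) I"
    using assms(1) by (auto simp: inj_on_def I_def nth_eq_iff_index_eq)
  ultimately show ?thesis by (simp add: card_image)
qed

lemma large_end_set_exists:
  assumes "spanning_path_to E T z xs" "\<And>x. {x} \<notin> E"
  obtains S where "S \<subseteq> T" "\<And>x. x \<in> S \<Longrightarrow> \<exists>ys. spanning_path_to E T z ys \<and> hd ys = x"
    and "\<And>ys. spanning_path_to E T z ys \<Longrightarrow> card (neighbors_in E (hd ys) T) \<le> card S"
proof -
  have "finite T" using assms(1) by (auto simp: spanning_path_to_def)
  then have "\<forall>ys. spanning_path_to E T z ys \<longrightarrow> card (neighbors_in E (hd ys) T) < Suc (card T)"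
    by (auto simp: neighbors_in_def less_Suc_eq_le intro: card_mono)
  then obtain ys where ys: "spanning_path_to E T z ys"
    and maximal: "\<And>zs. spanning_path_to E T z zs
      \<Longrightarrow> card (neighbors_in E (hd zs) T) \<le> card (neighbors_in E (hd ys) T)"
    using ex_has_greatest_nat[of "spanning_path_to E T z" xs
        "\<lambda>ys. card (neighbors_in E (hd ys) T)" "Suc (card T)"] assms(1) by blast
  have "card (rotation_ends E ys) = card (neighbors_in E (hd ys) T)"
    using card_rotation_ends[of ys E] ys assms(2)
    by (auto simp: spanning_path_to_def graph_path_def)
  moreover have "rotation_ends E ys \<subseteq> T"
    using ys by (auto simp: rotation_ends_def spanning_path_to_def)
  ultimately show thesis
    using that spanning_path_from_rotation_end[OF ys] maximal by metis
qed

section \<open>Longest paths\<close>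

definition longest_path :: "'a set set \<Rightarrow> 'a set \<Rightarrow> 'a list \<Rightarrow> bool" where
  "longest_path E D xs \<longleftrightarrow>
     graph_path E D xs \<and> (\<forall>ys. graph_path E D ys \<longrightarrow> length ys \<le> length xs)"

lemma longest_pathD:
  assumes "longest_path E D xs"
  shows "graph_path E D xs" "xs \<noteq> []" "distinct xs" "set xs \<subseteq> D" "hd xs \<in> D" "last xs \<in> D"
  using assms graph_pathD[of E D xs] by (simp_all add: longest_path_def)

lemma longest_path_rev [simp]: "longest_path E D (rev xs) \<longleftrightarrow> longest_path E D xs"
  by (simp add: longest_path_def)

lemma longest_path_exists:
  assumes "finite D" "D \<noteq> {}"
  obtains xs where "longest_path E D xs"
proof -
  obtain x where "x \<in> D" using assms(2) by blast
  then have "graph_path E D [x]" by simp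
  moreover have "\<forall>xs. graph_path E D xs \<longrightarrow> length xs < Suc (card D)"
    using assms(1) by (metis card_mono distinct_card graph_pathD(2,3) le_imp_less_Suc)
  ultimately obtain xs where "graph_path E D xs"
    "\<forall>ys. graph_path E D ys \<longrightarrow> length ys \<le> length xs"
    using ex_has_greatest_nat[of "graph_path E D" "[x]" length "Suc (card D)"] by blast
  then show thesis using that by (simp add: longest_path_def)
qed

lemma longest_path_hd_neighbors:
  assumes "longest_path E D xs"
  shows "neighbors_in E (hd xs) D \<subseteq> set xs"
proof (rule ccontr)
  assume "\<not> ?thesis"
  then obtain y where "y \<in> D" "{hd xs, y} \<in> E" "y \<notin> set xs"
    by (auto simp: neighbors_in_def)
  then have "graph_path E D ([y] @ xs)"
    using longest_pathD[OF assms] by (subst graph_path_append) (auto simp: insert_commute)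
  then show False using assms by (force simp: longest_path_def)
qed

lemma longest_path_hd_degree:
  assumes "longest_path E D xs" "{hd xs} \<notin> E"
  shows "card (neighbors_in E (hd xs) D) < length xs"
proof -
  have "hd xs \<notin> neighbors_in E (hd xs) D" using assms(2) by (simp add: neighbors_in_def)
  then have "neighbors_in E (hd xs) D \<subset> set xs"
    using longest_path_hd_neighbors[OF assms(1)] hd_in_set[OF longest_pathD(2)[OF assms(1)]]
    by blast
  then show ?thesis
    using longest_pathD(3)[OF assms(1)] by (metis List.finite_set distinct_card psubset_card_mono)
qed

lemma longest_path_length_ge_2:
  assumes "longest_path E D xs" "{hd xs} \<notin> E" "finite D" "neighbors_in E (hd xs) D \<noteq> {}"
  shows "2 \<le> length xs"
proof -
  have "0 < card (neighbors_in E (hd xs) D)"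
    using assms(3,4) by (simp add: card_gt_0_iff neighbors_in_def)
  then show ?thesis using longest_path_hd_degree[OF assms(1,2)] by simp
qed

lemma longest_path_replace_prefix:
  assumes longest: "longest_path E D (ps @ ss)" and "ps \<noteq> []"
    and spanning: "spanning_path_to E (set ps) (last ps) qs"
  shows "longest_path E D (qs @ ss)" and "last (qs @ ss) = last (ps @ ss)"
    and "hd (qs @ ss) = hd qs" and "length qs = length ps"
proof -
  have qs: "qs \<noteq> []" "distinct qs" "set qs = set ps" "last qs = last ps" "graph_path E (set ps) qs"
    using spanning graph_pathD[of E "set ps" qs] by (simp_all add: spanning_path_to_def)
  note path = longest_pathD[OF longest]
  then have "set qs \<subseteq> D" using qs(3) by simp
  then have "graph_path E D qs" using qs(5) graph_path_superset by blast
  then have "graph_path E D (qs @ ss)"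
    using path(1) qs assms(2) by (cases "ss = []") (auto simp: graph_path_append)
  moreover show "length qs = length ps"
    using qs(2,3) path(3) by (metis distinct_append distinct_card)
  ultimately show "longest_path E D (qs @ ss)" using longest by (simp add: longest_path_def)
  show "last (qs @ ss) = last (ps @ ss)" using qs(1,4) assms(2) by (simp add: last_append)
  show "hd (qs @ ss) = hd qs" using qs(1) by simp
qed

definition lollipop :: "'a set set \<Rightarrow> 'a set \<Rightarrow> 'a \<Rightarrow> 'a list \<Rightarrow> 'a list \<Rightarrow> bool" where
  "lollipop E D z ps ss \<longleftrightarrow>
     ps \<noteq> [] \<and> {last ps, hd ps} \<in> E \<and> longest_path E D (ps @ ss) \<and> last (ps @ ss) = z"

lemma lollipop_of_hd_neighbor:
  assumes "longest_path E D xs" "v \<in> neighbors_in E (hd xs) D"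
  obtains ps ss where "lollipop E D (last xs) ps ss" "xs = ps @ ss" "last ps = v"
proof -
  have "v \<in> set xs" using longest_path_hd_neighbors assms by blast
  then obtain us ws where "xs = (us @ [v]) @ ws" by (auto dest: split_list)
  moreover from this have "hd xs = hd (us @ [v])" by (simp add: hd_append)
  ultimately show thesis
    using that[of "us @ [v]" ws] assms by (simp add: lollipop_def neighbors_in_def insert_commute)
qed

lemma maximal_lollipop_exists:
  assumes "longest_path E D xs" "neighbors_in E (hd xs) D \<noteq> {}"
  obtains ps ss where "lollipop E D (last xs) ps ss"
    and "\<And>qs. spanning_path_to E (set ps) (last ps) qs \<Longrightarrow> neighbors_in E (hd qs) D \<subseteq> set ps"
proof -
  let ?P = "\<lambda>ps. \<exists>ss. lollipop E D (last xs) ps ss"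
  obtain v where "v \<in> neighbors_in E (hd xs) D" using assms(2) by blast
  then obtain ps0 where "?P ps0" using lollipop_of_hd_neighbor[OF assms(1)] by metis
  moreover have "length ps < Suc (length xs)" if lollipop: "?P ps" for ps
  proof -
    obtain ss where "graph_path E D (ps @ ss)"
      using lollipop longest_pathD(1) unfolding lollipop_def by blast
    then have "length (ps @ ss) \<le> length xs" using assms(1) unfolding longest_path_def by blast
    then show ?thesis by simp
  qed
  ultimately obtain ps ss where ps: "lollipop E D (last xs) ps ss"
    and maximal: "\<And>rs ts. lollipop E D (last xs) rs ts \<Longrightarrow> length rs \<le> length ps"
    using ex_has_greatest_nat[of ?P ps0 length "Suc (length xs)"] by blast
  have "neighbors_in E (hd qs) D \<subseteq> set ps"
    if spanning: "spanning_path_to E (set ps) (last ps) qs" for qs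
  proof
    fix v assume v: "v \<in> neighbors_in E (hd qs) D"
    have qs: "longest_path E D (qs @ ss)" "last (qs @ ss) = last xs" "hd (qs @ ss) = hd qs"
      "length qs = length ps"
      using longest_path_replace_prefix[OF _ _ spanning] ps by (auto simp: lollipop_def)
    obtain rs ts where rs: "lollipop E D (last xs) rs ts" "qs @ ss = rs @ ts" "last rs = v"
      using lollipop_of_hd_neighbor[OF qs(1)] v qs(2,3) by metis
    then have "length rs \<le> length qs" using maximal qs(4) by metis
    then have "set rs \<subseteq> set qs"
      using rs(2) by (metis append_eq_append_conv_if set_take_subset)
    moreover have "v \<in> set rs" using rs(1,3) by (auto simp: lollipop_def)
    ultimately show "v \<in> set ps" using spanning by (auto simp: spanning_path_to_def)
  qed
  with ps that show thesis by blast
qed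

lemma closing_segment_with_end_set_exists:
  assumes longest: "longest_path E D xs"
    and nonempty: "\<And>ys. longest_path E D ys \<Longrightarrow> last ys = last xs \<Longrightarrow> neighbors_in E (hd ys) D \<noteq> {}"
    and no_loop: "\<And>x. {x} \<notin> E"
  obtains ps S where "graph_path E D ps" "{last ps, hd ps} \<in> E" "S \<noteq> {}" "S \<subseteq> set ps"
    and "\<And>x. x \<in> S \<Longrightarrow> \<exists>ys. longest_path E D ys \<and> last ys = last xs \<and> hd ys = x"
    and "\<And>x. x \<in> S \<Longrightarrow> neighbors_in E x D \<subseteq> set ps"
    and "\<And>x. x \<in> S \<Longrightarrow> card (neighbors_in E x D) \<le> card S"
proof -
  obtain ps ss where "lollipop E D (last xs) ps ss" and closed:
    "\<And>qs. spanning_path_to E (set ps) (last ps) qs \<Longrightarrow> neighbors_in E (hd qs) D \<subseteq> set ps"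
    using maximal_lollipop_exists[OF longest nonempty[OF longest refl]] by blast
  then have ps: "ps \<noteq> []" "{last ps, hd ps} \<in> E" "longest_path E D (ps @ ss)"
    "last (ps @ ss) = last xs"
    by (simp_all add: lollipop_def)
  have path: "graph_path E D ps" using longest_pathD(1)[OF ps(3)] ps(1) by (rule graph_path_prefix)
  note spanning = spanning_path_to_self[OF path]
  have neighbors_eq: "neighbors_in E (hd qs) (set ps) = neighbors_in E (hd qs) D"
    if "spanning_path_to E (set ps) (last ps) qs" for qs
    using closed[OF that] graph_pathD(3)[OF path] by (auto simp: neighbors_in_def)
  obtain S where S: "S \<subseteq> set ps"
    "\<And>x. x \<in> S \<Longrightarrow> \<exists>qs. spanning_path_to E (set ps) (last ps) qs \<and> hd qs = x"
    and degree_le: "\<And>qs. spanning_path_to E (set ps) (last ps) qs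
      \<Longrightarrow> card (neighbors_in E (hd qs) (set ps)) \<le> card S"
    using large_end_set_exists[OF spanning no_loop] by blast
  have "neighbors_in E (hd ps) (set ps) \<noteq> {}"
    using nonempty[OF ps(3,4)] ps(1) neighbors_eq[OF spanning] by simp
  then have "0 < card (neighbors_in E (hd ps) (set ps))"
    by (simp add: card_gt_0_iff neighbors_in_def)
  then have "S \<noteq> {}" using degree_le[OF spanning] by auto
  then show thesis
  proof (rule that[OF path ps(2) _ S(1)])
    fix x assume "x \<in> S"
    then obtain qs where qs: "spanning_path_to E (set ps) (last ps) qs" "hd qs = x"
      using S(2) by blast
    show "\<exists>ys. longest_path E D ys \<and> last ys = last xs \<and> hd ys = x"
      using longest_path_replace_prefix[OF ps(3,1) qs(1)] ps(4) qs(2) by metis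
    show "neighbors_in E x D \<subseteq> set ps" "card (neighbors_in E x D) \<le> card S"
      using closed[OF qs(1)] degree_le[OF qs(1)] neighbors_eq[OF qs(1)] qs(2) by simp_all
  qed
qed

section \<open>Arcs of a cycle\<close>

definition arc_length :: "nat \<Rightarrow> nat \<Rightarrow> nat \<Rightarrow> nat" where
  "arc_length c i j = (if i \<le> j then j - i else c + j - i)"

lemma arc_length_add_swap:
  assumes "i < c" "j < c" "i \<noteq> j"
  shows "arc_length c i j + arc_length c j i = c"
  using assms by (auto simp: arc_length_def)

lemma add_arc_length_mod:
  assumes "i < c" "j < c"
  shows "(i + arc_length c i j) mod c = j"
  using assms by (auto simp: arc_length_def)

lemma arc_length_less:
  assumes "i < c" "j < c"
  shows "arc_length c i j < c"
  using assms by (auto simp: arc_length_def)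

lemma arc_length_pos:
  assumes "i < c" "i \<noteq> j"
  shows "0 < arc_length c i j"
  using assms by (auto simp: arc_length_def)

lemma arc_length_between:
  assumes "i < c" "l < c" "j < c" "l \<noteq> i" "arc_length c i l < arc_length c i j"
  shows "arc_length c l j < arc_length c i j"
  using assms by (auto simp: arc_length_def split: if_splits)

definition arc :: "nat \<Rightarrow> nat \<Rightarrow> nat \<Rightarrow> nat set" where
  "arc c i w = {x. x < c \<and> arc_length c i x < w}"

lemma card_arc:
  assumes "i < c" "w \<le> c"
  shows "card (arc c i w) = w"
proof -
  have "bij_betw (arc_length c i) (arc c i w) {..<w}"
  proof (rule bij_betw_byWitness)
    show "\<forall>x\<in>arc c i w. (i + arc_length c i x) mod c = x"
      using assms(1) by (simp add: arc_def add_arc_length_mod)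
    show "\<forall>u\<in>{..<w}. arc_length c i ((i + u) mod c) = u"
      "(\<lambda>u. (i + u) mod c) ` {..<w} \<subseteq> arc c i w"
      using assms by (auto simp: arc_def arc_length_def mod_if)
  qed (auto simp: arc_def)
  then show ?thesis by (auto dest: bij_betw_same_card)
qed

lemma disjoint_arcs:
  assumes "i < c" "j < c" "v \<le> arc_length c i j" "w \<le> arc_length c j i"
  shows "arc c i v \<inter> arc c j w = {}"
  using assms by (auto simp: arc_def arc_length_def split: if_splits)

lemma sum_gaps_le:
  assumes I: "I \<subseteq> {..<c}" "2 \<le> card I"
    and gap: "\<And>i j. i \<in> I \<Longrightarrow> j \<in> I \<Longrightarrow> i \<noteq> j \<Longrightarrow> w i \<le> arc_length c i j"
  shows "(\<Sum>i\<in>I. w i) \<le> c"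
proof -
  have finite_I: "finite I" using I(1) finite_subset by blast
  have w_le: "w i \<le> c" if "i \<in> I" for i
  proof -
    have "\<not> I \<subseteq> {i}" using I(2) card_mono[of "{i}" I] by auto
    then obtain j where "j \<in> I" "j \<noteq> i" by blast
    then have "w i \<le> arc_length c i j" "arc_length c i j < c"
      using that gap I(1) by (auto intro: arc_length_less)
    then show ?thesis by simp
  qed
  have "(\<Sum>i\<in>I. w i) = (\<Sum>i\<in>I. card (arc c i (w i)))"
    using I(1) w_le by (intro sum.cong) (auto simp: card_arc)
  also have "\<dots> = card (\<Union>i\<in>I. arc c i (w i))"
    using finite_I I(1) gap
    by (intro card_UN_disjoint[symmetric] ballI impI disjoint_arcs) (auto simp: arc_def)
  also have "\<dots> \<le> card {..<c}" by (intro card_mono) (auto simp: arc_def)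
  finally show ?thesis by simp
qed

lemma uniform_gap_bound:
  assumes "I \<subseteq> {..<c}" "2 \<le> card I"
    and "\<And>i j. i \<in> I \<Longrightarrow> j \<in> I \<Longrightarrow> i \<noteq> j \<Longrightarrow> g \<le> arc_length c i j"
  shows "card I * g \<le> c"
  using sum_gaps_le[of I c "\<lambda>_. g"] assms by simp

lemma wide_gap_exists:
  assumes X: "X \<subseteq> {..<c}" "X \<noteq> {}" and Y: "Y \<subseteq> {..<c}" "Y \<noteq> {}" and "X \<inter> Y = {}"
    and gap: "\<And>x y. x \<in> X \<Longrightarrow> y \<in> Y \<Longrightarrow> g \<le> arc_length c x y"
  obtains i where "i \<in> X" "\<And>l. l \<in> X \<union> Y \<Longrightarrow> l \<noteq> i \<Longrightarrow> g \<le> arc_length c i l"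
proof -
  obtain y where y: "y \<in> Y" using Y(2) by blast
  obtain i where i: "i \<in> X"
    and closest: "\<And>x. x \<in> X \<Longrightarrow> arc_length c i y \<le> arc_length c x y"
    using X(2) ex_has_least_nat[of "\<lambda>x. x \<in> X" _ "\<lambda>x. arc_length c x y"] by blast
  have "g \<le> arc_length c i l" if l: "l \<in> X \<union> Y" "l \<noteq> i" for l
  proof (cases "l \<in> Y")
    case False
    then have "l \<in> X" using l(1) by blast
    then have "\<not> arc_length c i l < arc_length c i y"
      using arc_length_between[of i c l y] closest[of l] i y l(2) X(1) Y(1) by auto
    then show ?thesis using gap[OF i y] by simp
  qed (use gap i in blast)
  with i that show thesis by blast
qed

lemma two_wide_gaps_bound:
  assumes X: "X \<subseteq> {..<c}" "X \<noteq> {}" and Y: "Y \<subseteq> {..<c}" "Y \<noteq> {}" and disjoint: "X \<inter> Y = {}"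
    and wide: "\<And>x y. x \<in> X \<Longrightarrow> y \<in> Y \<Longrightarrow> g \<le> arc_length c x y \<and> g \<le> arc_length c y x"
    and narrow: "\<And>l m. l \<in> X \<union> Y \<Longrightarrow> m \<in> X \<union> Y \<Longrightarrow> l \<noteq> m \<Longrightarrow> h \<le> arc_length c l m"
  shows "2 * g + (card (X \<union> Y) - 2) * h \<le> c"
proof -
  obtain i where i: "i \<in> X" "\<And>l. l \<in> X \<union> Y \<Longrightarrow> l \<noteq> i \<Longrightarrow> g \<le> arc_length c i l"
    using wide_gap_exists[OF X Y disjoint] wide by metis
  obtain j where j: "j \<in> Y" "\<And>l. l \<in> X \<union> Y \<Longrightarrow> l \<noteq> j \<Longrightarrow> g \<le> arc_length c j l"
    using wide_gap_exists[OF Y X] disjoint wide by (metis Int_commute Un_commute)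
  have finite_Un: "finite (X \<union> Y)" using X(1) Y(1) finite_subset by blast
  have ij: "{i, j} \<subseteq> X \<union> Y" "i \<noteq> j" using i(1) j(1) disjoint by auto
  then have card_ij: "card {i, j} = 2" by simp
  define w where "w l = (if l \<in> {i, j} then g else h)" for l
  have "(\<Sum>l\<in>X \<union> Y. w l) \<le> c"
  proof (rule sum_gaps_le)
    show "2 \<le> card (X \<union> Y)" using card_mono[OF finite_Un ij(1)] card_ij by simp
  qed (use X(1) Y(1) i(2) j(2) narrow in \<open>auto simp: w_def\<close>)
  moreover have "(\<Sum>l\<in>X \<union> Y. w l) = (\<Sum>l\<in>X \<union> Y - {i, j}. h) + (\<Sum>l\<in>{i, j}. g)"
    unfolding sum.subset_diff[OF ij(1) finite_Un]
    by (intro arg_cong2[of _ _ _ _ "(+)"] sum.cong) (auto simp: w_def)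
  moreover have "card (X \<union> Y - {i, j}) = card (X \<union> Y) - 2"
    using card_Diff_subset[of "{i, j}"] ij(1) card_ij by simp
  ultimately show ?thesis using card_ij by simp
qed

section \<open>Cycles and their attachments\<close>

lemma is_cycle_of_path:
  assumes "graph_path E V xs" "3 \<le> length xs" "{last xs, hd xs} \<in> E"
  shows "is_cycle V E xs"
  unfolding is_cycle_def
proof (intro conjI allI impI)
  fix i assume i: "i < length xs"
  show "{xs ! i, xs ! (Suc i mod length xs)} \<in> E"
  proof (cases "Suc i < length xs")
    case True
    then show ?thesis using assms(1) by (simp add: graph_path_def successively_conv_nth)
  next
    case False
    with i have "i = length xs - 1" "xs \<noteq> []" by auto
    then show ?thesis using assms(3) by (simp add: last_conv_nth hd_conv_nth)
  qed
qed (use assms in \<open>auto simp: graph_path_def\<close>)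

lemma is_cycle_rotate:
  assumes "is_cycle V E C"
  shows "is_cycle V E (rotate m C)"
proof -
  have "{rotate m C ! i, rotate m C ! (Suc i mod length C)} \<in> E" if "i < length C" for i
  proof -
    let ?j = "(m + i) mod length C"
    have nonempty: "0 < length C" using that by linarith
    then have "?j < length C" by (rule mod_less_divisor)
    then have "{C ! ?j, C ! (Suc ?j mod length C)} \<in> E" using assms by (simp add: is_cycle_def)
    then show ?thesis
      using that mod_less_divisor[OF nonempty, of "Suc i"] by (simp add: nth_rotate mod_simps)
  qed
  then show ?thesis using assms by (simp add: is_cycle_def)
qed

lemma graph_path_of_cycle:
  assumes "is_cycle V E C"
  shows "graph_path E V C"
proof -
  have "{C ! i, C ! Suc i} \<in> E" if "Suc i < length C" for i
    using assms that unfolding is_cycle_def by (metis Suc_lessD mod_less)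
  then show ?thesis using assms by (auto simp: is_cycle_def graph_path_def successively_conv_nth)
qed

lemma path_along_cycle:
  assumes "is_cycle V E C" "i < length C" "d < length C"
  obtains ys where "graph_path E V ys" "set ys \<subseteq> set C" "length ys = Suc d"
    "hd ys = C ! i" "last ys = C ! ((i + d) mod length C)"
proof -
  let ?R = "rotate i C"
  have "?R = take (Suc d) ?R @ drop (Suc d) ?R" by simp
  then have "graph_path E V (take (Suc d) ?R)"
    using graph_path_prefix graph_path_of_cycle is_cycle_rotate assms(1,2)
    by (metis length_0_conv not_less_zero rotate_is_Nil_conv take_eq_Nil2 nat.distinct(1))
  moreover have "set (take (Suc d) ?R) \<subseteq> set C" using set_take_subset by fastforce
  moreover have "hd (take (Suc d) ?R) = C ! i"
    using assms(2) by (cases "C = []") (simp_all add: hd_rotate_conv_nth)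
  moreover have "last (take (Suc d) ?R) = C ! ((i + d) mod length C)"
    using assms(3) by (simp add: take_Suc_conv_app_nth nth_rotate)
  ultimately show thesis using that assms(3) by simp
qed

lemma cycle_bypass:
  assumes C: "is_cycle V E C" and path: "graph_path E (V - set C) xs"
    and ij: "i < length C" "j < length C" "i \<noteq> j"
    and "{hd xs, C ! i} \<in> E" "{last xs, C ! j} \<in> E"
  obtains C' where "is_cycle V E C'" "length C' = length xs + Suc (arc_length (length C) j i)"
proof -
  obtain ys where ys: "graph_path E V ys" "set ys \<subseteq> set C"
    "length ys = Suc (arc_length (length C) j i)" "hd ys = C ! j" "last ys = C ! i"
    using path_along_cycle[OF C ij(2) arc_length_less] ij add_arc_length_mod by metis
  have nonempty: "xs \<noteq> []" "ys \<noteq> []" and "set xs \<subseteq> V - set C"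
    using graph_pathD[OF path] graph_pathD[OF ys(1)] by simp_all
  then have "graph_path E V xs" "set ys \<inter> set xs = {}"
    using path ys(2) graph_path_superset by blast+
  then have "graph_path E V (ys @ xs)"
    using ys nonempty assms(6) by (simp add: graph_path_append insert_commute)
  moreover have "2 \<le> length ys" using ys(3) arc_length_pos[of j "length C" i] ij by simp
  then have "3 \<le> length (ys @ xs)" using nonempty(1) by (cases xs) auto
  ultimately have "is_cycle V E (ys @ xs)"
    using ys(4) nonempty assms(7) by (intro is_cycle_of_path) auto
  then show thesis using that ys(3) by simp
qed

lemma cycle_through_common_neighbor:
  assumes "graph_path E (V - W) xs" "2 \<le> length xs" "v \<in> V \<inter> W"
    and "{hd xs, v} \<in> E" "{last xs, v} \<in> E"
  shows "is_cycle V E (v # xs)"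
proof (rule is_cycle_of_path)
  have "xs \<noteq> []" "set xs \<subseteq> V - W" using graph_pathD[OF assms(1)] by simp_all
  moreover from this have "graph_path E V xs" using assms(1) graph_path_superset by blast
  ultimately have "graph_path E V ([v] @ xs)"
    using assms(3,4) by (subst graph_path_append) (auto simp: insert_commute)
  then show "graph_path E V (v # xs)" by simp
  show "{last (v # xs), hd (v # xs)} \<in> E" using assms(5) \<open>xs \<noteq> []\<close> by simp
qed (use assms(2) in simp)

definition positions :: "'a list \<Rightarrow> 'a set \<Rightarrow> nat set" where
  "positions xs X = {i. i < length xs \<and> xs ! i \<in> X}"

lemma positions_subset: "positions xs X \<subseteq> {..<length xs}"
  by (auto simp: positions_def)

lemma card_positions:
  assumes "distinct xs"
  shows "card (positions xs X) = card (X \<inter> set xs)"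
proof -
  have "inj_on ((!) xs) (positions xs X)"
    using assms by (auto simp: inj_on_def positions_def nth_eq_iff_index_eq)
  moreover have "(!) xs ` positions xs X = X \<inter> set xs"
    by (auto simp: positions_def in_set_conv_nth)
  ultimately show ?thesis by (metis card_image)
qed

locale longest_cycle_graph =
  fixes V :: "'a set" and E :: "'a set set" and C :: "'a list"
  assumes longest: "longest_cycle V E C"
begin

abbreviation attachments :: "'a \<Rightarrow> 'a set" where
  "attachments x \<equiv> neighbors_in E x (set C)"

lemma cycle: "is_cycle V E C" "distinct C" "set C \<subseteq> V"
  using longest by (auto simp: longest_cycle_def is_cycle_def)

lemma attachment_gap:
  assumes path: "graph_path E (V - set C) xs"
    and i: "i \<in> positions C (attachments (hd xs))"
    and j: "j \<in> positions C (attachments (last xs))" and "i \<noteq> j"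
  shows "length xs + 1 \<le> arc_length (length C) i j"
proof -
  have i_attached: "i < length C" "{hd xs, C ! i} \<in> E"
    and j_attached: "j < length C" "{last xs, C ! j} \<in> E"
    using i j by (auto simp: positions_def neighbors_in_def)
  obtain C' where "is_cycle V E C'" "length C' = length xs + Suc (arc_length (length C) j i)"
    using cycle_bypass[OF cycle(1) path i_attached(1) j_attached(1) \<open>i \<noteq> j\<close>
        i_attached(2) j_attached(2)] .
  then have "length xs + Suc (arc_length (length C) j i) \<le> length C"
    using longest unfolding longest_cycle_def by metis
  then show ?thesis using arc_length_add_swap[OF i_attached(1) j_attached(1) \<open>i \<noteq> j\<close>] by simp
qed

lemma attachment_gap_swap:
  assumes path: "graph_path E (V - set C) xs"
    and "i \<in> positions C (attachments (hd xs))" "j \<in> positions C (attachments (last xs))" "i \<noteq> j"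
  shows "length xs + 1 \<le> arc_length (length C) j i"
  using attachment_gap[of "rev xs" j i] assms graph_pathD(1)[OF path]
  by (simp add: hd_rev last_rev)

lemma attachment_gap_ge_2:
  assumes path: "graph_path E (V - set C) xs"
    and l: "l \<in> positions C (attachments (hd xs) \<union> attachments (last xs))"
    and m: "m \<in> positions C (attachments (hd xs) \<union> attachments (last xs))" and "l \<noteq> m"
  shows "2 \<le> arc_length (length C) l m"
proof -
  let ?A = "positions C (attachments (hd xs))" and ?B = "positions C (attachments (last xs))"
  have vertex: "2 \<le> arc_length (length C) l m"
    if "x \<in> V - set C" "l \<in> positions C (attachments x)" "m \<in> positions C (attachments x)" for x
    using attachment_gap[of "[x]" l m] that \<open>l \<noteq> m\<close> by simp
  have "1 \<le> length xs" using graph_pathD(1)[OF path] by (simp add: Suc_le_eq)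
  consider (hd_hd) "l \<in> ?A" "m \<in> ?A" | (last_last) "l \<in> ?B" "m \<in> ?B"
    | (hd_last) "l \<in> ?A" "m \<in> ?B" | (last_hd) "l \<in> ?B" "m \<in> ?A"
    using l m by (auto simp: positions_def)
  then show ?thesis
  proof cases
    case hd_hd
    then show ?thesis using vertex graph_pathD(4)[OF path] by blast
  next
    case last_last
    then show ?thesis using vertex graph_pathD(5)[OF path] by blast
  next
    case hd_last
    then show ?thesis using attachment_gap[OF path _ _ \<open>l \<noteq> m\<close>] \<open>1 \<le> length xs\<close> by fastforce
  next
    case last_hd
    then show ?thesis
      using attachment_gap_swap[OF path _ _ \<open>l \<noteq> m\<close>[symmetric]] \<open>1 \<le> length xs\<close> by fastforce
  qed
qed

lemma card_positions_attachments:
  "card (positions C (attachments x \<union> attachments y)) = card (attachments x \<union> attachments y)"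
proof -
  have "(attachments x \<union> attachments y) \<inter> set C = attachments x \<union> attachments y"
    by (auto simp: neighbors_in_def)
  then show ?thesis by (simp add: card_positions cycle(2))
qed

lemma equal_attachments_bound:
  assumes path: "graph_path E (V - set C) xs"
    and equal: "attachments (hd xs) = attachments (last xs)"
    and "2 \<le> card (attachments (hd xs))"
  shows "card (attachments (hd xs)) * (length xs + 1) \<le> length C"
proof -
  have card_eq: "card (positions C (attachments (hd xs))) = card (attachments (hd xs))"
    using card_positions_attachments[of "hd xs" "hd xs"] by simp
  have "card (positions C (attachments (hd xs))) * (length xs + 1) \<le> length C"
    using assms(3) attachment_gap[OF path] equal card_eq
    by (intro uniform_gap_bound positions_subset) auto
  then show ?thesis using card_eq by simp
qed

lemma unequal_attachments_bound:
  assumes path: "graph_path E (V - set C) xs"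
    and "\<not> attachments (hd xs) \<subseteq> attachments (last xs)" "attachments (last xs) \<noteq> {}"
  shows "2 * length xs + 2 * card (attachments (hd xs) \<union> attachments (last xs)) \<le> length C + 2"
proof -
  let ?A = "positions C (attachments (hd xs))" and ?B = "positions C (attachments (last xs))"
  have nonempty: "?A - ?B \<noteq> {}" "?B \<noteq> {}"
    using assms(2,3) by (fastforce simp: positions_def neighbors_in_def in_set_conv_nth)+
  have union: "?A - ?B \<union> ?B = positions C (attachments (hd xs) \<union> attachments (last xs))"
    by (auto simp: positions_def)
  have "2 * (length xs + 1) + (card (?A - ?B \<union> ?B) - 2) * 2 \<le> length C"
  proof (rule two_wide_gaps_bound)
    show "2 \<le> arc_length (length C) l m"
      if "l \<in> ?A - ?B \<union> ?B" "m \<in> ?A - ?B \<union> ?B" "l \<noteq> m" for l m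
      using attachment_gap_ge_2[OF path] that unfolding union by blast
  qed (use nonempty positions_subset attachment_gap[OF path] attachment_gap_swap[OF path] in blast)+
  then show ?thesis using union card_positions_attachments by simp
qed

lemma attachments_bound:
  assumes path: "graph_path E (V - set C) xs"
    and nonempty: "attachments (hd xs) \<noteq> {}" "attachments (last xs) \<noteq> {}"
    and two_attachments: "2 \<le> card (attachments (hd xs) \<union> attachments (last xs))"
  shows "2 * length xs + 2 * card (attachments (hd xs) \<union> attachments (last xs)) \<le> length C + 2"
proof -
  consider (not_subset) "\<not> attachments (hd xs) \<subseteq> attachments (last xs)"
    | (not_superset) "\<not> attachments (last xs) \<subseteq> attachments (hd xs)"
    | (equal) "attachments (hd xs) = attachments (last xs)" by blast
  then show ?thesis
  proof cases
    case not_subset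
    then show ?thesis using unequal_attachments_bound path nonempty(2) by blast
  next
    case not_superset
    then show ?thesis
      using unequal_attachments_bound[of "rev xs"] path nonempty(1) graph_pathD(1)[OF path]
      by (simp add: hd_rev last_rev Un_commute)
  next
    case equal
    have "card (attachments (hd xs)) * (length xs + 1) \<le> length C"
      using equal_attachments_bound path equal two_attachments by simp
    moreover obtain p where "length xs = Suc p"
      using graph_pathD(1)[OF path] by (cases xs) auto
    moreover obtain a where "card (attachments (hd xs)) = a + 2"
      using two_attachments equal by (metis Un_absorb add.commute le_Suc_ex)
    ultimately show ?thesis using equal by (simp add: algebra_simps)
  qed
qed

end

section \<open>Counting edges\<close>

lemma simple_graph_card_edge: "simple_graph V E \<Longrightarrow> e \<in> E \<Longrightarrow> card e = 2"
  by (simp add: simple_graph_def)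

lemma simple_graph_no_loop: "simple_graph V E \<Longrightarrow> {x} \<notin> E"
  using simple_graph_card_edge[of V E "{x}"] by auto

lemma simple_graph_finite_edges:
  assumes "simple_graph V E"
  shows "finite E"
  using assms by (auto simp: simple_graph_def intro: finite_subset[of E "Pow V"])

lemma finite_neighbors_in: "finite A \<Longrightarrow> finite (neighbors_in E x A)"
  by (simp add: neighbors_in_def)

lemma neighbors_in_Un: "neighbors_in E x (A \<union> B) = neighbors_in E x A \<union> neighbors_in E x B"
  by (auto simp: neighbors_in_def)

lemma edges_betweenI: "{a, b} \<in> E \<Longrightarrow> a \<in> A \<Longrightarrow> b \<in> B \<Longrightarrow> {a, b} \<in> edges_between E A B"
  by (auto simp: edges_between_def)

lemma edges_between_Un:
  "edges_between E A (B \<union> B') = edges_between E A B \<union> edges_between E A B'"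
  by (auto simp: edges_between_def)

lemma edges_between_eq_UN:
  "edges_between E A B = (\<Union>x\<in>A. (\<lambda>v. {x, v}) ` neighbors_in E x B)"
  by (auto simp: edges_between_def neighbors_in_def)

lemma finite_edges_between: "finite A \<Longrightarrow> finite B \<Longrightarrow> finite (edges_between E A B)"
  by (simp add: edges_between_eq_UN finite_neighbors_in)

lemma card_edges_between_le:
  assumes "finite A" "finite B"
  shows "card (edges_between E A B) \<le> (\<Sum>x\<in>A. card (neighbors_in E x B))"
  unfolding edges_between_eq_UN using assms
  by (intro order_trans[OF card_UN_le] sum_mono card_image_le finite_neighbors_in)

lemma edges_within_eq_between:
  assumes "\<And>e. e \<in> E \<Longrightarrow> card e = 2"
  shows "edges_within E A = edges_between E A A"
proof -
  have "\<exists>a\<in>A. \<exists>b\<in>A. e = {a, b}" if "e \<in> E" "e \<subseteq> A" for e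
    using assms[OF that(1)] that(2) by (auto simp: card_2_iff)
  then show ?thesis by (auto simp: edges_within_def edges_between_def)
qed

lemma card_edges_within_plus_between:
  assumes "\<And>e. e \<in> E \<Longrightarrow> card e = 2" "finite A" "finite B" "A \<inter> B = {}"
  shows "card (edges_within E A) + card (edges_between E A B) = card (edges_between E A (A \<union> B))"
proof -
  have within: "edges_within E A = edges_between E A A"
    using assms(1) by (rule edges_within_eq_between)
  have "edges_within E A \<inter> edges_between E A B = {}"
    using assms(4) by (auto simp: edges_within_def edges_between_def)
  then show ?thesis
    using assms(2,3) by (simp add: within edges_between_Un card_Un_disjoint finite_edges_between)
qed

lemma card_ordered_edges:
  assumes "finite F" "\<And>e. e \<in> F \<Longrightarrow> card e = 2"
  shows "card {(x, y). {x, y} \<in> F} = 2 * card F"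
proof -
  have two_orientations:
    "finite {(x, y). {x, y} = e} \<and> card {(x, y). {x, y} = e} = 2" if "e \<in> F" for e
  proof -
    obtain a b where "e = {a, b}" "a \<noteq> b" using assms(2)[OF \<open>e \<in> F\<close>] by (auto simp: card_2_iff)
    then have "{(x, y). {x, y} = e} = {(a, b), (b, a)}" by (auto simp: doubleton_eq_iff)
    then show ?thesis using \<open>a \<noteq> b\<close> by simp
  qed
  have "{(x, y). {x, y} \<in> F} = (\<Union>e\<in>F. {(x, y). {x, y} = e})" by auto
  moreover have "card \<dots> = (\<Sum>e\<in>F. card {(x, y). {x, y} = e})"
    using assms(1) two_orientations by (intro card_UN_disjoint) auto
  ultimately show ?thesis using two_orientations by simp
qed

lemma handshake_edges_between:
  assumes "finite T" "S \<subseteq> T" "\<And>e. e \<in> E \<Longrightarrow> card e = 2"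
  shows "2 * card (edges_between E S T)
    = (\<Sum>x\<in>S. card (neighbors_in E x T)) + (\<Sum>x\<in>T - S. card (neighbors_in E x S))"
proof -
  let ?F = "edges_between E S T"
  have finite_S: "finite S" using assms(2,1) by (rule finite_subset)
  then have finite_F: "finite ?F" using assms(1) by (rule finite_edges_between)
  have "{(x, y). {x, y} \<in> ?F}
      = (SIGMA x:S. neighbors_in E x T) \<union> (SIGMA x:T - S. neighbors_in E x S)"
    using assms(2)
    by (auto simp: edges_between_def neighbors_in_def doubleton_eq_iff insert_commute)
  moreover have "card \<dots> = card (SIGMA x:S. neighbors_in E x T)
      + card (SIGMA x:T - S. neighbors_in E x S)"
    using finite_S assms(1) by (intro card_Un_disjoint) (auto simp: finite_neighbors_in)
  moreover have "card {(x, y). {x, y} \<in> ?F} = 2 * card ?F"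
    using finite_F assms(3) by (intro card_ordered_edges) (auto simp: edges_between_def)
  ultimately show ?thesis
    using finite_S assms(1) by (simp add: card_SigmaI finite_neighbors_in)
qed

lemma double_card_edges_between_le:
  assumes "finite T" "S \<subseteq> T" "\<And>e. e \<in> E \<Longrightarrow> card e = 2"
    and degree: "\<And>x. x \<in> S \<Longrightarrow> card (neighbors_in E x T) \<le> a"
  shows "2 * card (edges_between E S T) \<le> card S * (a + (card T - card S))"
proof -
  have finite_S: "finite S" using assms(2,1) by (rule finite_subset)
  have "(\<Sum>x\<in>S. card (neighbors_in E x T)) \<le> card S * a"
    using sum_bounded_above[of S "\<lambda>x. card (neighbors_in E x T)" a] degree by simp
  moreover have "card (neighbors_in E x S) \<le> card S" for x
    using finite_S by (intro card_mono) (auto simp: neighbors_in_def)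
  then have "(\<Sum>x\<in>T - S. card (neighbors_in E x S)) \<le> card (T - S) * card S"
    using sum_bounded_above[of "T - S" "\<lambda>x. card (neighbors_in E x S)" "card S"] by simp
  moreover have "card (T - S) = card T - card S" using finite_S assms(2) by (rule card_Diff_subset)
  ultimately show ?thesis
    using handshake_edges_between[OF assms(1-3)] by (simp add: algebra_simps)
qed

lemma edges_between_split:
  "edges_between E D (D \<union> B)
    \<subseteq> edges_between E (D - S) (D - S \<union> B) \<union> edges_between E S (D \<union> B)"
proof
  fix e assume "e \<in> edges_between E D (D \<union> B)"
  then obtain a b where e: "e = {a, b}" "{a, b} \<in> E" "a \<in> D" "b \<in> D \<union> B"
    by (auto simp: edges_between_def)
  consider (left) "a \<in> S" | (right) "b \<in> S"
    | (outside) "a \<in> D - S" "b \<in> D - S \<union> B" using e(3,4) by blast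
  then show "e \<in> edges_between E (D - S) (D - S \<union> B) \<union> edges_between E S (D \<union> B)"
  proof cases
    case left
    then show ?thesis using e by (intro UnI2) (simp add: edges_betweenI)
  next
    case right
    then have "{b, a} \<in> edges_between E S (D \<union> B)"
      using e by (intro edges_betweenI) (auto simp: insert_commute)
    then show ?thesis using e(1) by (simp add: insert_commute)
  next
    case outside
    then show ?thesis using e by (intro UnI1) (simp add: edges_betweenI)
  qed
qed

text \<open>
  The two vertex sets of \<^const>\<open>edges_between\<close> may overlap. For \<open>S \<subseteq> D\<close>, the edges counted here are all
  those inside \<open>D \<union> B\<close> that are incident with \<open>S\<close>.
\<close>

definition hereditarily_dense :: "'a set set \<Rightarrow> nat \<Rightarrow> 'a set \<Rightarrow> 'a set \<Rightarrow> bool" where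
  "hereditarily_dense E m D B \<longleftrightarrow>
     (\<forall>S\<subseteq>D. S \<noteq> {} \<longrightarrow> m * card S < card (edges_between E S (D \<union> B)))"

lemma hereditarily_dense_subset_exists:
  assumes "finite E" "finite W" "m * card W < card (edges_between E W (W \<union> B))"
  obtains D where "D \<subseteq> W" "D \<noteq> {}" "hereditarily_dense E m D B"
proof -
  define dense where
    "dense D \<longleftrightarrow> D \<subseteq> W \<and> m * card D < card (edges_between E D (D \<union> B))" for D
  have "dense W" using assms(3) by (simp add: dense_def)
  then obtain D where "dense D" and minimal: "\<And>D'. dense D' \<Longrightarrow> card D \<le> card D'"
    using ex_has_least_nat[of dense W card] by blast
  then have D: "D \<subseteq> W" "m * card D < card (edges_between E D (D \<union> B))"
    by (simp_all add: dense_def)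
  have "m * card S < card (edges_between E S (D \<union> B))" if S: "S \<subseteq> D" "S \<noteq> {}" for S
  proof -
    let ?R = "D - S"
    have finite_D: "finite D" using D(1) assms(2) by (rule finite_subset)
    have finite_S: "finite S" using S(1) finite_D by (rule finite_subset)
    have card_R: "card ?R + card S = card D"
      using finite_D finite_S S(1) by (simp add: card_Diff_subset card_mono)
    moreover have "0 < card S" using finite_S S(2) by (simp add: card_gt_0_iff)
    ultimately have "\<not> card D \<le> card ?R" by simp
    then have "\<not> dense ?R" using minimal by blast
    then have "card (edges_between E ?R (?R \<union> B)) \<le> m * card ?R"
      using D(1) by (auto simp: dense_def)
    moreover have "card (edges_between E D (D \<union> B))
        \<le> card (edges_between E ?R (?R \<union> B)) + card (edges_between E S (D \<union> B))"
      using assms(1)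
      by (intro order_trans[OF card_mono[OF _ edges_between_split] card_Un_le])
        (simp add: edges_between_def)
    moreover have "m * card D = m * card ?R + m * card S"
      by (simp add: card_R[symmetric] add_mult_distrib2)
    ultimately show ?thesis using D(2) by linarith
  qed
  then have "hereditarily_dense E m D B" by (simp add: hereditarily_dense_def)
  moreover have "D \<noteq> {}" using D(2) by (auto simp: edges_between_def)
  ultimately show thesis using that D(1) by blast
qed

section \<open>Hereditarily dense sets outside a longest cycle\<close>

lemma (in longest_cycle_graph) dense_set_outside_cycle_exists:
  assumes graph: "simple_graph V E"
    and edges: "m * (card V - length C)
      < card (edges_within E (V - set C)) + card (edges_between E (V - set C) (set C))"
  obtains D where "D \<subseteq> V - set C" "D \<noteq> {}" "hereditarily_dense E m D (set C)"
proof -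
  let ?W = "V - set C"
  have finite_W: "finite ?W" using graph by (simp add: simple_graph_def)
  have "card (edges_within E ?W) + card (edges_between E ?W (set C))
      = card (edges_between E ?W (?W \<union> set C))"
    using finite_W simple_graph_card_edge[OF graph]
    by (intro card_edges_within_plus_between) auto
  moreover have "card ?W = card V - length C"
    using cycle(2,3) by (simp add: card_Diff_subset distinct_card)
  ultimately have "m * card ?W < card (edges_between E ?W (?W \<union> set C))" using edges by simp
  with simple_graph_finite_edges[OF graph] finite_W show thesis
    using that by (rule hereditarily_dense_subset_exists)
qed

locale dense_outside_cycle = longest_cycle_graph V E C
  for V :: "'a set" and E :: "'a set set" and C :: "'a list" +
  fixes D :: "'a set" and k :: nat
  assumes graph: "simple_graph V E"
    and k_def: "k = length C div 2"
    and k_ge_2: "2 \<le> k"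
    and D_subset: "D \<subseteq> V - set C"
    and D_nonempty: "D \<noteq> {}"
    and dense: "hereditarily_dense E (k - 1) D (set C)"
begin

abbreviation inner_neighbors :: "'a \<Rightarrow> 'a set" where
  "inner_neighbors x \<equiv> neighbors_in E x D"

lemma finite_D: "finite D"
  using graph D_subset by (meson finite_Diff finite_subset simple_graph_def)

lemma finite_attachments: "finite (attachments x)"
  by (simp add: finite_neighbors_in)

lemmas no_loop = simple_graph_no_loop[OF graph]

lemma dense_set_bound:
  assumes S: "S \<noteq> {}" "S \<subseteq> T" and "T \<subseteq> D"
    and closed: "\<And>x. x \<in> S \<Longrightarrow> inner_neighbors x \<subseteq> T"
    and inner: "\<And>x. x \<in> S \<Longrightarrow> card (inner_neighbors x) \<le> a"
    and outer: "\<And>x. x \<in> S \<Longrightarrow> card (attachments x) \<le> b"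
  shows "2 * (k - 1) < a + (card T - card S) + 2 * b"
proof -
  have finite_T: "finite T" using \<open>T \<subseteq> D\<close> finite_D by (rule finite_subset)
  have finite_S: "finite S" using S(2) finite_T by (rule finite_subset)
  have neighbors_eq: "neighbors_in E x T = inner_neighbors x" if "x \<in> S" for x
    using closed[OF that] \<open>T \<subseteq> D\<close> by (auto simp: neighbors_in_def)
  then have "edges_between E S D = edges_between E S T" by (simp add: edges_between_eq_UN)
  then have "card (edges_between E S (D \<union> set C))
      \<le> card (edges_between E S T) + card (edges_between E S (set C))"
    by (simp add: edges_between_Un card_Un_le)
  moreover have "2 * card (edges_between E S T) \<le> card S * (a + (card T - card S))"
    using double_card_edges_between_le finite_T S(2) simple_graph_card_edge[OF graph] inner
      neighbors_eq
    by metis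
  moreover have "card (edges_between E S (set C)) \<le> (\<Sum>x\<in>S. card (attachments x))"
    using finite_S by (simp add: card_edges_between_le)
  moreover have "\<dots> \<le> card S * b"
    using sum_bounded_above[of S "\<lambda>x. card (attachments x)" b] outer by simp
  moreover have "(k - 1) * card S < card (edges_between E S (D \<union> set C))"
    using dense S \<open>T \<subseteq> D\<close> by (simp add: hereditarily_dense_def)
  ultimately have "2 * ((k - 1) * card S) < card S * (a + (card T - card S)) + 2 * (card S * b)"
    by linarith
  then have "card S * (2 * (k - 1)) < card S * (a + (card T - card S) + 2 * b)"
    by (simp only: algebra_simps)
  then show ?thesis by (simp only: mult_less_cancel1)
qed

lemma degree_ge:
  assumes "x \<in> D"
  shows "k \<le> card (inner_neighbors x) + card (attachments x)"
proof -
  have "(k - 1) * card {x} < card (edges_between E {x} (D \<union> set C))"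
    using dense assms by (simp only: hereditarily_dense_def) blast
  then have "k - 1 < card (edges_between E {x} (D \<union> set C))" by simp
  also have "\<dots> \<le> card (inner_neighbors x \<union> attachments x)"
    using card_edges_between_le[of "{x}" "D \<union> set C" E] finite_D by (simp add: neighbors_in_Un)
  also have "\<dots> \<le> card (inner_neighbors x) + card (attachments x)" by (rule card_Un_le)
  finally show ?thesis by simp
qed

lemma card_attachments_le:
  assumes "x \<in> D"
  shows "card (attachments x) \<le> k"
proof (cases "2 \<le> card (attachments x)")
  case True
  have "graph_path E (V - set C) [x]" using assms D_subset by auto
  from equal_attachments_bound[OF this] True show ?thesis by (simp add: k_def)
qed (use k_ge_2 in simp)

lemma longest_path_outside:
  assumes "longest_path E D xs"
  shows "graph_path E (V - set C) xs"
  using longest_pathD[OF assms] D_subset by (auto intro: graph_path_superset)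

definition attached_ends :: "'a list \<Rightarrow> bool" where
  "attached_ends xs \<longleftrightarrow>
     longest_path E D xs \<and> attachments (hd xs) \<noteq> {} \<and> attachments (last xs) \<noteq> {}"

lemma attached_ends_tight:
  assumes ends: "attached_ends xs"
    and two_attachments: "2 \<le> card (attachments (hd xs) \<union> attachments (last xs))"
  shows "attachments (hd xs) = attachments (last xs)"
    and "card (attachments (hd xs)) + length xs = k + 1"
    and "card (inner_neighbors (hd xs)) + 1 = length xs"
proof -
  let ?A = "attachments (hd xs)" and ?B = "attachments (last xs)"
  have longest_xs: "longest_path E D xs" using ends by (simp add: attached_ends_def)
  have "2 * length xs + 2 * card (?A \<union> ?B) \<le> length C + 2"
    using attachments_bound[OF longest_path_outside[OF longest_xs]] ends two_attachments
    by (simp add: attached_ends_def)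
  then have upper: "length xs + card (?A \<union> ?B) \<le> k + 1" by (simp add: k_def)
  have inner: "card (inner_neighbors (hd xs)) < length xs"
    "card (inner_neighbors (last xs)) < length xs"
    using longest_path_hd_degree[OF longest_xs no_loop]
      longest_path_hd_degree[of E D "rev xs", OF _ no_loop] longest_xs
      longest_pathD(2)[OF longest_xs]
    by (simp_all add: hd_rev)
  have degrees: "k \<le> card (inner_neighbors (hd xs)) + card ?A"
    "k \<le> card (inner_neighbors (last xs)) + card ?B"
    using degree_ge longest_pathD(5,6)[OF longest_xs] by blast+
  have union: "card ?A \<le> card (?A \<union> ?B)" "card ?B \<le> card (?A \<union> ?B)"
    by (simp_all add: card_mono finite_attachments)
  have "card ?A = card (?A \<union> ?B)" "card ?B = card (?A \<union> ?B)"
    using upper inner degrees union by linarith+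
  then have "?A = ?A \<union> ?B" "?B = ?A \<union> ?B"
    by (meson Un_upper1 Un_upper2 card_subset_eq finite_UnI finite_attachments)+
  then show "?A = ?B" by simp
  show "card ?A + length xs = k + 1" "card (inner_neighbors (hd xs)) + 1 = length xs"
    using upper inner(1) degrees(1) union(1) by linarith+
qed

lemma longest_path_from_vertex:
  assumes longest_xs: "longest_path E D xs"
    and full: "card (inner_neighbors (hd xs)) + 1 = length xs" and y: "y \<in> set xs"
  obtains ys where "longest_path E D ys" "set ys = set xs" "hd ys = y" "last ys \<in> {hd xs, last xs}"
proof (cases "y = last xs")
  case True
  then show thesis
    using that[of "rev xs"] longest_xs longest_pathD(2)[OF longest_xs]
    by (simp add: hd_rev last_rev)
next
  case False
  note xs = longest_pathD[OF longest_xs]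
  have "hd xs \<notin> inner_neighbors (hd xs)" using no_loop by (simp add: neighbors_in_def)
  then have "inner_neighbors (hd xs) \<subseteq> set xs - {hd xs}"
    using longest_path_hd_neighbors[OF longest_xs] by blast
  then have all_adjacent: "inner_neighbors (hd xs) = set xs - {hd xs}"
    using full xs(2,3) by (intro card_subset_eq) (auto simp: distinct_card)
  obtain i where i: "i < length xs" "xs ! i = y" using y by (auto simp: in_set_conv_nth)
  then have "i \<noteq> length xs - 1" using False xs(2) by (auto simp: last_conv_nth)
  then have "Suc i < length xs" using i(1) by linarith
  moreover from this have "xs ! Suc i \<in> inner_neighbors (hd xs)"
    using all_adjacent xs(2,3) by (simp add: hd_conv_nth nth_eq_iff_index_eq)
  ultimately have "y \<in> rotation_ends E xs"
    using i(2) by (auto simp: rotation_ends_def neighbors_in_def)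
  then obtain ys where ys: "spanning_path_to E (set xs) (last xs) ys" "hd ys = y"
    using spanning_path_from_rotation_end spanning_path_to_self[OF xs(1)] by metis
  moreover have "longest_path E D ys"
    using longest_path_replace_prefix(1)[of E D xs "[]" ys] longest_xs xs(2) ys(1) by simp
  ultimately show thesis using that by (auto simp: spanning_path_to_def)
qed

lemma attached_ends_vertex:
  assumes ends: "attached_ends xs"
    and two_attachments: "2 \<le> card (attachments (hd xs) \<union> attachments (last xs))"
    and y: "y \<in> set xs"
  shows "inner_neighbors y \<subseteq> set xs" and "card (inner_neighbors y) < length xs"
    and "attachments y = attachments (hd xs)"
proof -
  let ?A = "attachments (hd xs)"
  note tight = attached_ends_tight[OF ends two_attachments]
  have longest_xs: "longest_path E D xs" and "?A \<noteq> {}"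
    using ends by (simp_all add: attached_ends_def)
  obtain ys where ys: "longest_path E D ys" "set ys = set xs" "hd ys = y"
    and "last ys \<in> {hd xs, last xs}"
    using longest_path_from_vertex[OF longest_xs tight(3) y] .
  then have last_ys: "attachments (last ys) = ?A" using tight(1) by auto
  have "length ys = length xs"
    using ys(1,2) longest_xs by (metis distinct_card longest_pathD(3))
  then show inner: "card (inner_neighbors y) < length xs"
    using longest_path_hd_degree[OF ys(1) no_loop] ys(3) by simp
  show "inner_neighbors y \<subseteq> set xs" using longest_path_hd_neighbors[OF ys(1)] ys(2,3) by simp
  have "y \<in> D" using y longest_pathD(4)[OF longest_xs] by blast
  then have "card ?A \<le> card (attachments y)"
    using degree_ge[of y] inner tight(2) by linarith
  then have "attachments y \<noteq> {}" using \<open>?A \<noteq> {}\<close> finite_attachments[of "hd xs"] by auto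
  moreover have "2 \<le> card (attachments y \<union> ?A)"
    using two_attachments tight(1) card_mono[of "attachments y \<union> ?A" ?A]
    by (simp add: finite_attachments)
  ultimately show "attachments y = ?A"
    using attached_ends_tight(1)[of ys] ys(1,3) last_ys \<open>?A \<noteq> {}\<close>
    by (simp add: attached_ends_def)
qed

lemma attached_ends_length_le_2:
  assumes ends: "attached_ends xs"
    and two_attachments: "2 \<le> card (attachments (hd xs) \<union> attachments (last xs))"
  shows "length xs \<le> 2"
proof -
  let ?a = "card (attachments (hd xs))"
  have "longest_path E D xs" using ends by (simp add: attached_ends_def)
  note xs = longest_pathD[OF this]
  have "2 * (k - 1) < (length xs - 1) + (card (set xs) - card (set xs)) + 2 * ?a"
  proof (rule dense_set_bound)
    fix y assume "y \<in> set xs"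
    note vertex = attached_ends_vertex[OF ends two_attachments this]
    show "inner_neighbors y \<subseteq> set xs" "card (attachments y) \<le> ?a"
      using vertex(1,3) by simp_all
    show "card (inner_neighbors y) \<le> length xs - 1" using vertex(2) by linarith
  qed (use xs in simp_all)
  moreover have "1 \<le> length xs" using xs(2) by (simp add: Suc_le_eq)
  ultimately show ?thesis using attached_ends_tight(2)[OF ends two_attachments] by linarith
qed

lemma attached_ends_cycle_length:
  assumes ends: "attached_ends xs"
    and two_attachments: "2 \<le> card (attachments (hd xs) \<union> attachments (last xs))"
    and "2 \<le> length xs"
  shows "length C \<in> {6, 7, 9}"
proof -
  let ?a = "card (attachments (hd xs))"
  note tight = attached_ends_tight[OF ends two_attachments]
  have length_xs: "length xs = 2"
    using attached_ends_length_le_2[OF ends two_attachments] assms(3) by simp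
  then have "k = ?a + 1" using tight(2) by simp
  moreover have "2 \<le> ?a" using two_attachments tight(1) by simp
  moreover from this have "?a * 3 \<le> length C"
    using equal_attachments_bound[OF longest_path_outside tight(1)] ends length_xs
    by (simp add: attached_ends_def)
  moreover have "length C = 2 * k \<or> length C = 2 * k + 1" by (auto simp: k_def)
  ultimately show ?thesis by auto
qed

lemma attached_ends_card_le_1:
  assumes "attached_ends xs" "2 \<le> length xs" "length C \<notin> {6, 7, 9}"
  shows "card (attachments (hd xs) \<union> attachments (last xs)) \<le> 1"
  using attached_ends_cycle_length[OF assms(1) _ assms(2)] assms(3) by linarith

lemma card_attachments_hd_le_1:
  assumes "longest_path E D xs" "attachments (last xs) \<noteq> {}" "2 \<le> length xs"
    and "length C \<notin> {6, 7, 9}"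
  shows "card (attachments (hd xs)) \<le> 1"
proof (cases "attachments (hd xs) = {}")
  case False
  have "card (attachments (hd xs)) \<le> card (attachments (hd xs) \<union> attachments (last xs))"
    by (intro card_mono) (simp_all add: finite_attachments)
  also have "\<dots> \<le> 1"
    using False assms by (intro attached_ends_card_le_1) (simp_all add: attached_ends_def)
  finally show ?thesis .
qed simp

lemma cycle_from_sparse_attachment:
  assumes longest_xs: "longest_path E D xs" and b: "b + 2 \<le> k"
    and inner: "\<And>ys. longest_path E D ys \<Longrightarrow> last ys = last xs \<Longrightarrow> inner_neighbors (hd ys) \<noteq> {}"
    and outer: "\<And>ys. longest_path E D ys \<Longrightarrow> last ys = last xs \<Longrightarrow> card (attachments (hd ys)) \<le> b"
  obtains C' where "is_cycle V E C'" "set C' \<subseteq> D" "2 * k \<le> length C' + 2 * b + 1"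
proof -
  obtain ps S where ps: "graph_path E D ps" "{last ps, hd ps} \<in> E"
    and S: "S \<noteq> {}" "S \<subseteq> set ps"
    and ends: "\<And>x. x \<in> S \<Longrightarrow> \<exists>ys. longest_path E D ys \<and> last ys = last xs \<and> hd ys = x"
    and closed: "\<And>x. x \<in> S \<Longrightarrow> inner_neighbors x \<subseteq> set ps"
    and degree_le: "\<And>x. x \<in> S \<Longrightarrow> card (inner_neighbors x) \<le> card S"
    using closing_segment_with_end_set_exists[OF longest_xs inner no_loop] by metis
  have subset: "set ps \<subseteq> D" and card_ps: "card (set ps) = length ps"
    using graph_pathD[OF ps(1)] by (simp_all add: distinct_card)
  have "card (attachments x) \<le> b" if "x \<in> S" for x
    using ends[OF that] outer by metis
  then have "2 * (k - 1) < card S + (card (set ps) - card S) + 2 * b"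
    using S subset closed degree_le by (intro dense_set_bound)
  moreover have "card S \<le> card (set ps)" using S(2) by (simp add: card_mono)
  ultimately have length_ps: "2 * (k - 1) < length ps + 2 * b" using card_ps by simp
  have "graph_path E V ps" using subset D_subset by (intro graph_path_superset[OF ps(1)]) auto
  then have "is_cycle V E ps" using ps(2) length_ps b by (intro is_cycle_of_path) auto
  then show thesis using that subset length_ps by fastforce
qed

lemma cycle_through_common_attachment:
  assumes ends: "attached_ends xs" and length: "2 \<le> length xs" "length C \<notin> {6, 7, 9}"
  obtains C' where "is_cycle V E C'" "card (set C \<inter> set C') = 1" "length C' = length xs + 1"
proof -
  have "longest_path E D xs" using ends by (simp add: attached_ends_def)
  note path = longest_path_outside[OF this]
  obtain v w where v: "v \<in> attachments (hd xs)" and w: "w \<in> attachments (last xs)"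
    using ends by (auto simp: attached_ends_def)
  then have "v = w"
    using attached_ends_card_le_1[OF ends length]
    by (auto simp: card_le_Suc0_iff_eq finite_attachments)
  then have "is_cycle V E (v # xs)"
    using v w cycle(3) length(1)
    by (intro cycle_through_common_neighbor[OF path]) (auto simp: neighbors_in_def)
  moreover have "set C \<inter> set (v # xs) = {v}"
    using v graph_pathD(3)[OF path] by (auto simp: neighbors_in_def)
  ultimately show thesis using that[of "v # xs"] by simp
qed

lemma unattached_end_exists:
  assumes "\<nexists>xs. attached_ends xs"
  obtains xs where "longest_path E D xs"
    and "\<And>ys. longest_path E D ys \<Longrightarrow> last ys = last xs \<Longrightarrow> attachments (hd ys) = {}"
proof (cases "\<exists>xs. longest_path E D xs \<and> attachments (last xs) \<noteq> {}")
  case True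
  then obtain xs where xs: "longest_path E D xs" "attachments (last xs) \<noteq> {}" by blast
  then have "attachments (hd ys) = {}" if "longest_path E D ys" "last ys = last xs" for ys
    using assms that unfolding attached_ends_def by metis
  with that xs(1) show thesis by blast
next
  case False
  then have "attachments (hd ys) = {}" if "longest_path E D ys" for ys
    using longest_pathD(2)[OF that] that by (metis last_rev longest_path_rev)
  with that longest_path_exists[OF finite_D D_nonempty] show thesis by metis
qed

lemma almost_disjoint_cycle_exists:
  assumes not_full: "\<And>x. x \<in> D \<Longrightarrow> card (attachments x) \<noteq> k" and "length C \<notin> {6, 7, 9}"
  shows "\<exists>C'. is_cycle V E C' \<and> (set C \<inter> set C' = {} \<and> 2 * k - 3 \<le> length C'
    \<or> card (set C \<inter> set C') = 1 \<and> 2 * k - 1 \<le> length C')"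
proof -
  have inner: "inner_neighbors (hd xs) \<noteq> {}" if "longest_path E D xs" for xs
    using degree_ge card_attachments_le not_full longest_pathD(5)[OF that] by fastforce
  have length_ge: "2 \<le> length xs" if "longest_path E D xs" for xs
    using longest_path_length_ge_2[OF that no_loop finite_D inner[OF that]] .
  have disjoint: "set C \<inter> X = {}" if "X \<subseteq> D" for X using that D_subset by blast
  consider (unattached) "\<nexists>xs. attached_ends xs" | (k_eq_2) xs where "attached_ends xs" "k = 2"
    | (k_ge_3) xs where "attached_ends xs" "3 \<le> k" using k_ge_2 by fastforce
  then show ?thesis
  proof cases
    case unattached
    then obtain xs where xs: "longest_path E D xs"
      "\<And>ys. longest_path E D ys \<Longrightarrow> last ys = last xs \<Longrightarrow> attachments (hd ys) = {}"
      using unattached_end_exists by blast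
    then obtain C' where "is_cycle V E C'" "set C' \<subseteq> D" "2 * k \<le> length C' + 2 * 0 + 1"
      using cycle_from_sparse_attachment[OF xs(1), of 0] inner k_ge_2 by force
    then show ?thesis using disjoint by (intro exI[of _ C']) simp
  next
    case k_eq_2
    then have length_xs: "2 \<le> length xs" using length_ge by (simp add: attached_ends_def)
    then obtain C' where "is_cycle V E C'" "card (set C \<inter> set C') = 1" "length C' = length xs + 1"
      using cycle_through_common_attachment[OF k_eq_2(1) _ assms(2)] by blast
    then show ?thesis using k_eq_2(2) length_xs by (intro exI[of _ C']) simp
  next
    case k_ge_3
    then have xs: "longest_path E D xs" "attachments (last xs) \<noteq> {}"
      by (simp_all add: attached_ends_def)
    then have "card (attachments (hd ys)) \<le> 1" if "longest_path E D ys" "last ys = last xs" for ys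
      using card_attachments_hd_le_1[OF that(1) _ length_ge[OF that(1)] assms(2)] that(2) by simp
    then obtain C' where "is_cycle V E C'" "set C' \<subseteq> D" "2 * k \<le> length C' + 2 * 1 + 1"
      using cycle_from_sparse_attachment[OF xs(1), of 1] inner k_ge_3(2) by auto
    then show ?thesis using disjoint by (intro exI[of _ C']) simp
  qed
qed

end

theorem theorem3p2:
  fixes V :: "'a set" and E :: "'a set set" and C :: "'a list" and n c :: nat
  assumes "simple_graph V E"
    and "n = card V"
    and "longest_cycle V E C"
    and "c = length C"
    and "4 \<le> c" and "c \<le> n - 1"
    and "card (edges_within E (V - set C)) + card (edges_between E (V - set C) (set C))
           > (c div 2 - 1) * (n - c)"
  shows "c \<in> {6, 7, 9}
    \<or> (\<exists>u \<in> V - set C. card (neighbors_in E u (set C)) = c div 2)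
    \<or> (\<exists>C'. is_cycle V E C' \<and> card (set C \<inter> set C') \<le> 1
          \<and> (set C \<inter> set C' = {} \<longrightarrow> length C' \<ge> 2 * (c div 2) - 3)
          \<and> (card (set C \<inter> set C') = 1 \<longrightarrow> length C' \<ge> 2 * (c div 2) - 1))"
proof -
  interpret longest_cycle_graph V E C using assms(3) by unfold_locales
  obtain D where D: "D \<subseteq> V - set C" "D \<noteq> {}" "hereditarily_dense E (c div 2 - 1) D (set C)"
    using dense_set_outside_cycle_exists[OF assms(1)] assms(2,4,7) by blast
  interpret dense_outside_cycle V E C D "c div 2"
    using assms(1,4,5) D by unfold_locales auto
  show ?thesis
  proof (cases "c \<in> {6, 7, 9} \<or> (\<exists>u \<in> V - set C. card (attachments u) = c div 2)")
    case True
    then show ?thesis by blast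
  next
    case False
    then have "\<And>u. u \<in> D \<Longrightarrow> card (attachments u) \<noteq> c div 2" "length C \<notin> {6, 7, 9}"
      using D(1) assms(4) by blast+
    then obtain C' where "is_cycle V E C'"
      and "set C \<inter> set C' = {} \<and> 2 * (c div 2) - 3 \<le> length C'
        \<or> card (set C \<inter> set C') = 1 \<and> 2 * (c div 2) - 1 \<le> length C'"
      using almost_disjoint_cycle_exists by blast
    then show ?thesis by (intro disjI2 exI[of _ C']) auto
  qed
qed

end
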